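(* Let $T$ be the Takagi function, whose range on $[0,1]$ is $[0,\frac23]$, and for $y\in\mathbb{R}$ let $L(y)=\{x\in[0,1]:T(x)=y\}$. Then the set $$S_\infty^{uc}:=\{y: L(y)\ \text{is uncountably infinite}\}$$ is residual in the range $[0,\frac23]$ of $T$.
   Context: The Takagi function is $T(x)=\sum_{n=0}^\infty \frac{1}{2^n}\phi(2^n x)$, where $\phi(x)=\operatorname{dist}(x,\mathbb{Z})$ is the distance from $x$ to the nearest integer. A subset of $[0,\frac23]$ is residual in $[0,\frac23]$ if its complement in $[0,\frac23]$ is meager (of first category) in $[0,\frac23]$. *)

theory Defs
  imports "HOL-Analysis.Analysis"
begin

definition dist_to_int :: "real \<Rightarrow> real" where
  "dist_to_int x = infdist x \<int>"

definition takagi :: "real \<Rightarrow> real" where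
  "takagi x = (\<Sum>n. 1 / 2 ^ n * dist_to_int (2 ^ n * x))"

definition takagi_level :: "real \<Rightarrow> real set" where
  "takagi_level y = {x \<in> {0..1}. takagi x = y}"

definition S_inf_uc :: "real set" where
  "S_inf_uc = {y. uncountable (takagi_level y)}"

definition nowhere_dense_in :: "'a topology \<Rightarrow> 'a set \<Rightarrow> bool" where
  "nowhere_dense_in X A \<longleftrightarrow> A \<subseteq> topspace X \<and> X interior_of (X closure_of A) = {}"

definition meager_in :: "'a topology \<Rightarrow> 'a set \<Rightarrow> bool" where
  "meager_in X A \<longleftrightarrow> (\<exists>\<F>. countable \<F> \<and> (\<forall>B\<in>\<F>. nowhere_dense_in X B) \<and> A = \<Union>\<F>)"

definition residual_in :: "'a topology \<Rightarrow> 'a set \<Rightarrow> bool" where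
  "residual_in X A \<longleftrightarrow> A \<subseteq> topspace X \<and> meager_in X (topspace X - A)"

end

theory Submission
  imports Defs
begin

text \<open>
  On a dyadic interval of length \<open>2\<^sup>-\<^sup>n\<close> the graph of the Takagi function is an affine copy of the
  whole graph, with an added integer slope \<open>s\<close>. Passing to the left or right half changes \<open>s\<close> by
  \<open>+1\<close> or \<open>-1\<close>, so every dyadic interval contains one with \<open>s = 0\<close>, a ``hump'', on which the graph is
  similar to the whole graph. Hence humps are dense in the unit interval. By the symmetry
  \<open>x \<mapsto> 1 - x\<close>, a hump in the left half has a disjoint mirror image with the same range of values;
  so for a dense open set of values \<open>y\<close> in the range of any hump, \<open>y\<close> lies in the interior of the
  range of two disjoint subhumps. There are only countably many humps, so for all \<open>y\<close> outside a
  meager set this splitting can be iterated for ever, and the resulting binary tree of humps has a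
  point of the level set of \<open>y\<close> on each of its branches.
\<close>

subsection \<open>The Takagi function\<close>

lemma dist_to_int_le: "dist_to_int x \<le> \<bar>x - of_int k\<bar>"
  using infdist_le[of "of_int k" \<int> x] by (simp add: dist_to_int_def dist_real_def)

lemma dist_to_int_eq: "dist_to_int x = \<bar>x - of_int (round x)\<bar>"
proof (rule antisym[OF dist_to_int_le])
  show "\<bar>x - of_int (round x)\<bar> \<le> dist_to_int x"
    unfolding dist_to_int_def infdist_def
    by (auto intro!: cINF_greatest round_diff_minimal elim!: Ints_cases simp: dist_real_def)
qed

lemma dist_to_int_nonneg: "0 \<le> dist_to_int x"
  by (simp add: dist_to_int_eq)

lemma dist_to_int_le_half: "dist_to_int x \<le> 1 / 2"
  using of_int_round_abs_le[of x] by (simp add: dist_to_int_eq abs_minus_commute)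

lemma dist_to_int_add_of_int: "dist_to_int (x + of_int k) = dist_to_int x"
proof (rule antisym)
  show "dist_to_int (x + of_int k) \<le> dist_to_int x"
    using dist_to_int_le[of "x + of_int k" "round x + k"] by (simp add: dist_to_int_eq[of x])
  show "dist_to_int x \<le> dist_to_int (x + of_int k)"
    using dist_to_int_le[of x "round (x + of_int k) - k"]
    by (simp add: dist_to_int_eq[of "x + of_int k"] algebra_simps)
qed

lemma dist_to_int_minus: "dist_to_int (- x) = dist_to_int x"
proof -
  have "dist_to_int (- z) \<le> dist_to_int z" for z
    using dist_to_int_le[of "- z" "- round z"] by (simp add: dist_to_int_eq[of z])
  from this[of x] this[of "- x"] show ?thesis by simp
qed

lemma dist_to_int_lower_half: "x \<in> {0..1/2} \<Longrightarrow> dist_to_int x = x"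
proof (rule antisym)
  assume x: "x \<in> {0..1/2}"
  show "dist_to_int x \<le> x" using dist_to_int_le[of x 0] x by simp
  have "round x \<le> 0 \<or> round x \<ge> 1" by linarith
  then have "real_of_int (round x) \<le> 0 \<or> real_of_int (round x) \<ge> 1" by (metis of_int_1_le_iff of_int_le_0_iff)
  then show "x \<le> dist_to_int x" using x by (auto simp: dist_to_int_eq)
qed

lemma dist_to_int_upper_half: "x \<in> {1/2..1} \<Longrightarrow> dist_to_int x = 1 - x"
  using dist_to_int_lower_half[of "1 - x"] dist_to_int_add_of_int[of "- x" 1] dist_to_int_minus[of x]
  by simp

text \<open>With d the distance from \<open>x\<close> to its nearest integer k, whichever of 2k + 1
  and 2k - 1 lies on the side of \<open>2 * x\<close> is at distance 1 - 2d from it. Pairing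
  consecutive terms of the series in this way yields the sharp bound in
  \<open>takagi_le\<close>.\<close>

lemma dist_to_int_double: "dist_to_int x + dist_to_int (2 * x) / 2 \<le> 1 / 2"
proof -
  define k where "k = round x"
  have x: "dist_to_int x = \<bar>x - of_int k\<bar>" "\<bar>x - of_int k\<bar> \<le> 1 / 2"
    using dist_to_int_eq[of x] dist_to_int_le_half[of x] by (simp_all add: k_def)
  have "dist_to_int (2 * x) \<le> \<bar>2 * x - of_int m\<bar>" for m by (rule dist_to_int_le)
  from this[of "2 * k"] this[of "2 * k + 1"] this[of "2 * k - 1"] x
  show ?thesis by (auto simp: abs_if split: if_splits)
qed

lemma continuous_on_dist_to_int [continuous_intros]:
  "continuous_on S f \<Longrightarrow> continuous_on S (\<lambda>x. dist_to_int (f x))"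
  unfolding dist_to_int_def by (rule continuous_on_infdist)

lemma takagi_term_bound: "norm (1 / 2 ^ n * dist_to_int x) \<le> (1 / 2) ^ n"
  using dist_to_int_le_half[of x] dist_to_int_nonneg[of x] by (simp add: field_simps power_divide)

lemma summable_takagi: "summable (\<lambda>n. 1 / 2 ^ n * dist_to_int (2 ^ n * x))"
  by (rule summable_comparison_test'[OF summable_geometric[of "1/2::real"]])
     (use takagi_term_bound in auto)

lemma continuous_on_takagi: "continuous_on S takagi"
proof -
  have "uniform_limit UNIV (\<lambda>n x. \<Sum>i<n. 1 / 2 ^ i * dist_to_int (2 ^ i * x)) takagi sequentially"
    unfolding takagi_def
    by (rule Weierstrass_m_test[where M = "\<lambda>n. (1 / 2) ^ n"]) (use takagi_term_bound in auto)
  then have "continuous_on UNIV takagi"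
    by (rule uniform_limit_theorem[rotated]) (auto intro!: always_eventually continuous_intros)
  then show ?thesis by (rule continuous_on_subset) simp
qed

lemma takagi_rec: "takagi x = dist_to_int x + takagi (2 * x) / 2"
proof -
  have "takagi x = dist_to_int x + (\<Sum>n. 1 / 2 ^ Suc n * dist_to_int (2 ^ Suc n * x))"
    unfolding takagi_def using suminf_split_head[OF summable_takagi[of x]] by simp
  also have "(\<lambda>n. 1 / 2 ^ Suc n * dist_to_int (2 ^ Suc n * x))
      = (\<lambda>n. 1 / 2 * (1 / 2 ^ n * dist_to_int (2 ^ n * (2 * x))))"
    by (simp add: fun_eq_iff mult_ac)
  also have "suminf \<dots> = 1 / 2 * takagi (2 * x)"
    unfolding takagi_def by (rule suminf_mult[OF summable_takagi])
  finally show ?thesis by simp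
qed

lemma takagi_add_1: "takagi (x + 1) = takagi x"
proof -
  have "dist_to_int (2 ^ n * (x + 1)) = dist_to_int (2 ^ n * x)" for n
    using dist_to_int_add_of_int[of "2 ^ n * x" "2 ^ n"] by (simp add: algebra_simps)
  then show ?thesis by (simp add: takagi_def)
qed

lemma takagi_symmetric: "takagi (1 - x) = takagi x"
proof -
  have "takagi (- x) = takagi x"
    using dist_to_int_minus[of "2 ^ n * x" for n] by (simp add: takagi_def)
  then show ?thesis using takagi_add_1[of "- x"] by simp
qed

lemma takagi_left_half: "t \<in> {0..1} \<Longrightarrow> takagi (t / 2) = (takagi t + t) / 2"
  using takagi_rec[of "t / 2"] dist_to_int_lower_half[of "t / 2"] by simp

lemma takagi_right_half: "t \<in> {0..1} \<Longrightarrow> takagi ((t + 1) / 2) = (takagi t + 1 - t) / 2"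
  using takagi_rec[of "(t + 1) / 2"] dist_to_int_upper_half[of "(t + 1) / 2"] takagi_add_1[of t]
  by (auto simp: add_divide_distrib diff_divide_distrib)

lemma takagi_0: "takagi 0 = 0"
  using takagi_left_half[of 0] by simp

text \<open>Symmetry makes the values at 1/3 and 2/3 equal to some T, and the left-half formula then
  reads T = (T + 2/3) / 2.\<close>

lemma takagi_third: "takagi (1 / 3) = 2 / 3"
  using takagi_left_half[of "2 / 3"] takagi_symmetric[of "1 / 3"] by simp

lemma takagi_nonneg: "0 \<le> takagi x"
  unfolding takagi_def using dist_to_int_nonneg by (intro suminf_nonneg summable_takagi) simp

lemma takagi_le: "takagi x \<le> 2 / 3"
proof -
  \<comment> \<open>This crude bound only makes the supremum \<open>M\<close> finite.\<close>
  have "takagi z \<le> (\<Sum>n. (1 / 2) ^ n)" for z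
    unfolding takagi_def
    by (rule suminf_le) (use takagi_term_bound summable_takagi in \<open>auto intro: order_trans[OF abs_ge_self]\<close>)
  then have bdd: "bdd_above (range takagi)" by (intro bdd_aboveI2)
  define M where "M = (SUP z. takagi z)"
  have le_M: "takagi z \<le> M" for z unfolding M_def by (rule cSUP_upper[OF _ bdd]) simp
  \<comment> \<open>Two steps of the recursion: the first two terms contribute at most 1/2, and the
    rest is a quarter of a value of \<open>takagi\<close>. Taking the supremum gives a self-bounding
    inequality for \<open>M\<close>.\<close>
  have "takagi z \<le> 1 / 2 + M / 4" for z
    using takagi_rec[of z] takagi_rec[of "2 * z"] dist_to_int_double[of z] le_M[of "2 * (2 * z)"]
    by linarith
  then have "M \<le> 1 / 2 + M / 4" unfolding M_def by (intro cSUP_least) auto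
  then show ?thesis using le_M[of x] by simp
qed

text \<open>The argument is confined to [0, 1/3], between a minimum and a maximum of
  \<open>takagi\<close>; being away from 1/2, it leaves room for a disjoint mirror image in
  \<open>symmetric_humps\<close>.\<close>

lemma takagi_attains:
  assumes "y \<in> {0..2/3}"
  obtains x where "x \<in> {0..1/3}" "takagi x = y"
  using IVT'[of takagi 0 y "1/3"] assms continuous_on_takagi takagi_0 takagi_third by auto

lemma takagi_range: "takagi ` {0..1} = {0..2/3}"
proof
  show "takagi ` {0..1} \<subseteq> {0..2/3}" using takagi_nonneg takagi_le by auto
  show "{0..2/3} \<subseteq> takagi ` {0..1}"
  proof
    fix y :: real assume "y \<in> {0..2/3}"
    then obtain x where "x \<in> {0..1/3}" "takagi x = y" by (rule takagi_attains)
    then show "y \<in> takagi ` {0..1}" by force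
  qed
qed


subsection \<open>Affine and similar copies of the graph\<close>

text \<open>The slope \<open>s\<close> is the number of zeros minus the number of ones among the first \<open>n\<close> binary digits
  of \<open>a\<close>. Rationality of \<open>a\<close> serves only to make the set of humps countable.\<close>

definition takagi_cell :: "real \<Rightarrow> nat \<Rightarrow> int \<Rightarrow> bool" where
  "takagi_cell a n s \<longleftrightarrow> a \<in> \<rat> \<and> 0 \<le> a \<and> a + 1 / 2 ^ n \<le> 1 \<and>
    (\<forall>t\<in>{0..1}. takagi (a + t / 2 ^ n) = takagi a + (takagi t + of_int s * t) / 2 ^ n)"

lemma takagi_cell_eq:
  "takagi_cell a n s \<Longrightarrow> t \<in> {0..1} \<Longrightarrow>
    takagi (a + t / 2 ^ n) = takagi a + (takagi t + of_int s * t) / 2 ^ n"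
  by (simp add: takagi_cell_def)

text \<open>The term \<open>t\<close> in \<open>takagi_left_half\<close> raises the slope by
  one.\<close>

lemma takagi_cell_left:
  assumes "takagi_cell a n s"
  shows "takagi_cell a (Suc n) (s + 1)"
  unfolding takagi_cell_def
proof (intro conjI ballI)
  show "a \<in> \<rat>" "0 \<le> a" using assms by (auto simp: takagi_cell_def)
  have "1 / 2 ^ Suc n \<le> (1 / 2 ^ n :: real)" by (simp add: field_simps)
  then show "a + 1 / 2 ^ Suc n \<le> 1" using assms unfolding takagi_cell_def by linarith
  fix t :: real assume t: "t \<in> {0..1}"
  have "takagi (a + t / 2 ^ Suc n) = takagi a + (takagi (t / 2) + of_int s * (t / 2)) / 2 ^ n"
    using takagi_cell_eq[OF assms, of "t / 2"] t by simp
  also have "\<dots> = takagi a + (takagi t + of_int (s + 1) * t) / 2 ^ Suc n"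
    unfolding takagi_left_half[OF t] by (simp add: field_simps)
  finally show "takagi (a + t / 2 ^ Suc n) = takagi a + (takagi t + of_int (s + 1) * t) / 2 ^ Suc n" .
qed

lemma takagi_cell_right:
  assumes "takagi_cell a n s"
  shows "takagi_cell (a + 1 / 2 ^ Suc n) (Suc n) (s - 1)"
  unfolding takagi_cell_def
proof (intro conjI ballI)
  have a: "a \<in> \<rat>" "0 \<le> a" "a + 1 / 2 ^ n \<le> 1" using assms by (auto simp: takagi_cell_def)
  show "a + 1 / 2 ^ Suc n \<in> \<rat>" using a by (intro Rats_add Rats_divide Rats_power) auto
  show "0 \<le> a + 1 / 2 ^ Suc n" using a by simp
  show "a + 1 / 2 ^ Suc n + 1 / 2 ^ Suc n \<le> 1" using a by (simp add: field_simps)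
  fix t :: real assume t: "t \<in> {0..1}"
  \<comment> \<open>The value is first computed relative to the old left endpoint \<open>a\<close>;
    the instance \<open>u = 0\<close> then gives the height at the new one, to which the formula is
    rebased.\<close>
  have *: "takagi (a + 1 / 2 ^ Suc n + u / 2 ^ Suc n)
      = takagi a + (takagi u + 1 - u + of_int s * (u + 1)) / 2 ^ Suc n" if u: "u \<in> {0..1}" for u
  proof -
    have "a + 1 / 2 ^ Suc n + u / 2 ^ Suc n = a + ((u + 1) / 2) / 2 ^ n" by (simp add: field_simps)
    then have "takagi (a + 1 / 2 ^ Suc n + u / 2 ^ Suc n)
        = takagi a + (takagi ((u + 1) / 2) + of_int s * ((u + 1) / 2)) / 2 ^ n"
      unfolding \<open>a + _ + _ = _\<close> using u by (intro takagi_cell_eq[OF assms]) simp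
    also have "\<dots> = takagi a + (takagi u + 1 - u + of_int s * (u + 1)) / 2 ^ Suc n"
      unfolding takagi_right_half[OF u] by (simp add: field_simps)
    finally show ?thesis .
  qed
  from *[of 0] have "takagi (a + 1 / 2 ^ Suc n) = takagi a + (1 + of_int s) / 2 ^ Suc n"
    by (simp add: takagi_0)
  with *[OF t] show "takagi (a + 1 / 2 ^ Suc n + t / 2 ^ Suc n)
      = takagi (a + 1 / 2 ^ Suc n) + (takagi t + of_int (s - 1) * t) / 2 ^ Suc n"
    by (simp add: field_simps)
qed

section \<open>Humps: density, composition and reflection\<close>

definition takagi_humps :: "(real \<times> nat) set" where
  "takagi_humps = {(a, n). takagi_cell a n 0}"

definition hump_base :: "real \<times> nat \<Rightarrow> real set" where
  "hump_base = (\<lambda>(a, n). {a..a + 1 / 2 ^ n})"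

text \<open>The endpoints, which are also attained on the hump, are left out so that these intervals
  can serve as the open sets of the category argument.\<close>

definition hump_range :: "real \<times> nat \<Rightarrow> real set" where
  "hump_range = (\<lambda>(a, n). {takagi a<..<takagi a + 2 / 3 / 2 ^ n})"

lemma countable_takagi_humps: "countable takagi_humps"
proof (rule countable_subset)
  show "takagi_humps \<subseteq> \<rat> \<times> UNIV" by (auto simp: takagi_humps_def takagi_cell_def)
  show "countable (\<rat> \<times> (UNIV :: nat set))" by (intro countable_SIGMA countable_rat) auto
qed

lemma takagi_humps_iff:
  "(a, n) \<in> takagi_humps \<longleftrightarrow> a \<in> \<rat> \<and> 0 \<le> a \<and> a + 1 / 2 ^ n \<le> 1 \<and>
    (\<forall>t\<in>{0..1}. takagi (a + t / 2 ^ n) = takagi a + takagi t / 2 ^ n)"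
  by (simp add: takagi_humps_def takagi_cell_def)

lemma takagi_hump_eq:
  "(a, n) \<in> takagi_humps \<Longrightarrow> t \<in> {0..1} \<Longrightarrow> takagi (a + t / 2 ^ n) = takagi a + takagi t / 2 ^ n"
  by (simp add: takagi_humps_iff)

lemma unit_hump: "(0, 0) \<in> takagi_humps" "hump_range (0, 0) = {0<..<2/3}" "hump_base (0, 0) = {0..1}"
  by (simp_all add: takagi_humps_iff hump_range_def hump_base_def takagi_0)

text \<open>Induction on the absolute value of the slope: the right half is chosen when
  \<open>s\<close> is positive and the left half when it is negative, so each step brings the slope
  one closer to zero.\<close>

lemma takagi_cell_contains_hump:
  assumes "takagi_cell a n s"
  obtains b m where "(b, m) \<in> takagi_humps" "hump_base (b, m) \<subseteq> {a..a + 1 / 2 ^ n}"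
proof -
  have "\<exists>b m. takagi_cell b m 0 \<and> {b..b + 1 / 2 ^ m} \<subseteq> {a..a + 1 / 2 ^ n}"
    using assms
  proof (induction "nat \<bar>s\<bar>" arbitrary: a n s)
    case 0
    then show ?case by auto
  next
    case (Suc k)
    have sub: "{a..a + 1 / 2 ^ Suc n} \<subseteq> {a..a + 1 / 2 ^ n}"
      "{a + 1 / 2 ^ Suc n..a + 1 / 2 ^ Suc n + 1 / 2 ^ Suc n} \<subseteq> {a..a + 1 / 2 ^ n}"
      by (auto simp: field_simps)
    show ?case
    proof (cases "s > 0")
      case True
      with Suc(2) have "k = nat \<bar>s - 1\<bar>" by simp
      from Suc(1)[OF this takagi_cell_right[OF Suc(3)]] sub(2) show ?thesis by (meson subset_trans)
    next
      case False
      with Suc(2) have "k = nat \<bar>s + 1\<bar>" by simp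
      from Suc(1)[OF this takagi_cell_left[OF Suc(3)]] sub(1) show ?thesis by (meson subset_trans)
    qed
  qed
  then show thesis using that by (auto simp: takagi_humps_def hump_base_def)
qed

lemma takagi_cell_containing:
  assumes "x \<in> {0..1}"
  obtains a s where "takagi_cell a n s" "x \<in> {a..a + 1 / 2 ^ n}"
proof -
  have "\<exists>a s. takagi_cell a n s \<and> x \<in> {a..a + 1 / 2 ^ n}"
  proof (induction n)
    case 0
    have "takagi_cell 0 0 0" by (simp add: takagi_cell_def takagi_0)
    then show ?case using assms by force
  next
    case (Suc n)
    then obtain a s where c: "takagi_cell a n s" and x: "x \<in> {a..a + 1 / 2 ^ n}" by blast
    have "x \<in> {a..a + 1 / 2 ^ Suc n} \<or> x \<in> {a + 1 / 2 ^ Suc n..a + 1 / 2 ^ Suc n + 1 / 2 ^ Suc n}"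
      using x by (auto simp: field_simps)
    then show ?case using takagi_cell_left[OF c] takagi_cell_right[OF c] by blast
  qed
  then show thesis using that by blast
qed

lemma takagi_humps_dense:
  assumes "x \<in> {0..1}" "\<delta> > 0"
  obtains p where "p \<in> takagi_humps" "hump_base p \<subseteq> ball x \<delta>"
proof -
  obtain n where n: "(1 / 2) ^ n < \<delta>" using real_arch_pow_inv[OF assms(2), of "1/2"] by auto
  obtain a s where c: "takagi_cell a n s" and x: "x \<in> {a..a + 1 / 2 ^ n}"
    using takagi_cell_containing[OF assms(1)] by metis
  obtain b m where b: "(b, m) \<in> takagi_humps" "hump_base (b, m) \<subseteq> {a..a + 1 / 2 ^ n}"
    using takagi_cell_contains_hump[OF c] by metis
  moreover have "{a..a + 1 / 2 ^ n} \<subseteq> ball x \<delta>"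
    using x n by (auto simp: dist_real_def power_divide)
  ultimately show thesis using that[of "(b, m)"] by blast
qed

text \<open>Self-similarity: a hump inside the unit interval is transported into the hump
  \<open>(a, n)\<close>, so that splitting needs to be studied only for the whole graph.\<close>

lemma takagi_humps_comp:
  assumes a: "(a, n) \<in> takagi_humps" and b: "(b, m) \<in> takagi_humps"
  shows "(a + b / 2 ^ n, n + m) \<in> takagi_humps"
    and "hump_base (a + b / 2 ^ n, n + m) = (\<lambda>t. a + t / 2 ^ n) ` hump_base (b, m)"
    and "hump_range (a + b / 2 ^ n, n + m) = (\<lambda>y. takagi a + y / 2 ^ n) ` hump_range (b, m)"
proof -
  have b': "b \<in> \<rat>" "0 \<le> b" "b + 1 / 2 ^ m \<le> 1" and a': "a \<in> \<rat>" "0 \<le> a" "a + 1 / 2 ^ n \<le> 1"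
    using a b by (simp_all add: takagi_humps_iff)
  have "0 \<le> 1 / (2 ^ m :: real)" by simp
  with b' have bu: "b \<in> {0..1}" unfolding atLeastAtMost_iff by linarith
  have eq: "takagi (a + b / 2 ^ n) = takagi a + takagi b / 2 ^ n"
    by (rule takagi_hump_eq[OF a bu])
  have "takagi (a + b / 2 ^ n + t / 2 ^ (n + m)) = takagi (a + b / 2 ^ n) + takagi t / 2 ^ (n + m)"
    if t: "t \<in> {0..1}" for t
  proof -
    have "0 \<le> t / 2 ^ m" "t / 2 ^ m \<le> 1 / 2 ^ m" using t by (auto intro: divide_right_mono)
    with b' have "b + t / 2 ^ m \<in> {0..1}" unfolding atLeastAtMost_iff by linarith
    from takagi_hump_eq[OF a this] takagi_hump_eq[OF b t] eq show ?thesis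
      by (simp add: add_divide_distrib power_add mult_ac add_ac)
  qed
  moreover have "a + b / 2 ^ n \<in> \<rat>" using a' b' by (intro Rats_add Rats_divide Rats_power) auto
  moreover have "a + b / 2 ^ n + 1 / 2 ^ (n + m) \<le> 1"
  proof -
    have "a + b / 2 ^ n + 1 / 2 ^ (n + m) = a + (b + 1 / 2 ^ m) / 2 ^ n"
      by (simp add: add_divide_distrib power_add mult_ac)
    also have "\<dots> \<le> a + 1 / 2 ^ n" using b' by (intro add_left_mono divide_right_mono) auto
    finally show ?thesis using a' by simp
  qed
  ultimately show "(a + b / 2 ^ n, n + m) \<in> takagi_humps"
    using a' b' by (simp add: takagi_humps_iff)
  show "hump_base (a + b / 2 ^ n, n + m) = (\<lambda>t. a + t / 2 ^ n) ` hump_base (b, m)"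
    using image_affinity_atLeastAtMost[of "1 / 2 ^ n" a b "b + 1 / 2 ^ m"]
    by (simp add: hump_base_def add_divide_distrib power_add mult_ac add_ac)
  show "hump_range (a + b / 2 ^ n, n + m) = (\<lambda>y. takagi a + y / 2 ^ n) ` hump_range (b, m)"
  proof -
    have "(\<lambda>y. takagi a + y / 2 ^ n) ` {u<..<v} = {takagi a + u / 2 ^ n<..<takagi a + v / 2 ^ n}"
      for u v :: real
    proof (intro equalityI subsetI)
      fix z assume "z \<in> {takagi a + u / 2 ^ n<..<takagi a + v / 2 ^ n}"
      then show "z \<in> (\<lambda>y. takagi a + y / 2 ^ n) ` {u<..<v}"
        by (intro image_eqI[of _ _ "(z - takagi a) * 2 ^ n"]) (auto simp: field_simps)
    qed (auto simp: divide_strict_right_mono)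
    then show ?thesis
      by (simp add: hump_range_def eq add_divide_distrib power_add mult_ac add_ac)
  qed
qed

lemma hump_range_subset:
  assumes "p \<in> takagi_humps"
  shows "hump_range p \<subseteq> {0<..<2/3}"
proof -
  obtain a n where p: "p = (a, n)" by force
  \<comment> \<open>The upper end of the range is an actual value of \<open>takagi\<close>, taken at
    the copy of the maximum point 1/3.\<close>
  have "takagi (a + (1 / 3) / 2 ^ n) = takagi a + 2 / 3 / 2 ^ n"
    using takagi_hump_eq[of a n "1/3"] assms p by (simp add: takagi_third)
  then have "takagi a + 2 / 3 / 2 ^ n \<le> 2 / 3" using takagi_le[of "a + (1 / 3) / 2 ^ n"] by simp
  then show ?thesis using takagi_nonneg[of a] by (auto simp: p hump_range_def)
qed

lemma hump_range_attained:
  assumes "p \<in> takagi_humps" "y \<in> hump_range p"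
  shows "\<exists>x\<in>hump_base p. takagi x = y"
proof -
  obtain a n where p: "p = (a, n)" by force
  have "(y - takagi a) * 2 ^ n \<in> {0..2/3}" using assms(2) by (auto simp: p hump_range_def field_simps)
  then obtain t where t: "t \<in> {0..1/3}" "takagi t = (y - takagi a) * 2 ^ n" by (rule takagi_attains)
  then have "takagi (a + t / 2 ^ n) = y" using takagi_hump_eq[of a n t] assms(1) p by simp
  moreover have "a + t / 2 ^ n \<in> hump_base p" using t by (auto simp: p hump_base_def field_simps)
  ultimately show ?thesis by blast
qed

text \<open>The new base point is the left end of the mirrored interval. Reflection reverses the
  parameter to 1 - t, which the symmetry of the small copy undoes.\<close>

lemma takagi_hump_reflect:
  assumes "(a, n) \<in> takagi_humps"
  shows "(1 - a - 1 / 2 ^ n, n) \<in> takagi_humps" "takagi (1 - a - 1 / 2 ^ n) = takagi a"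
proof -
  have a: "a \<in> \<rat>" "0 \<le> a" "a + 1 / 2 ^ n \<le> 1" using assms by (auto simp: takagi_humps_iff)
  have *: "takagi (1 - a - 1 / 2 ^ n + t / 2 ^ n) = takagi a + takagi t / 2 ^ n"
    if "t \<in> {0..1}" for t
  proof -
    have "1 - a - 1 / 2 ^ n + t / 2 ^ n = 1 - (a + (1 - t) / 2 ^ n)"
      by (simp add: diff_divide_distrib)
    then have "takagi (1 - a - 1 / 2 ^ n + t / 2 ^ n) = takagi (a + (1 - t) / 2 ^ n)"
      by (simp only: takagi_symmetric)
    then show ?thesis
      using takagi_hump_eq[OF assms, of "1 - t"] that takagi_symmetric[of t] by simp
  qed
  from *[of 0] show "takagi (1 - a - 1 / 2 ^ n) = takagi a" by (simp add: takagi_0)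
  with * a show "(1 - a - 1 / 2 ^ n, n) \<in> takagi_humps"
    by (auto simp: takagi_humps_iff intro!: Rats_diff Rats_divide Rats_power)
qed

section \<open>Values covered by two disjoint subhumps\<close>

definition doubly_covered :: "real \<times> nat \<Rightarrow> real set" where
  "doubly_covered p = {y. \<exists>q\<in>takagi_humps. \<exists>r\<in>takagi_humps. hump_base q \<subseteq> hump_base p \<and>
    hump_base r \<subseteq> hump_base p \<and> hump_base q \<inter> hump_base r = {} \<and> y \<in> hump_range q \<and> y \<in> hump_range r}"

text \<open>A value in \<open>V\<close> is taken at some x in [0, 1/3]; a small hump near x stays in
  the left half and has values in \<open>V\<close>. Its mirror image is the second hump.\<close>

lemma symmetric_humps:
  assumes "open V" "V \<inter> {0<..<2/3} \<noteq> {}"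
  obtains q r where "q \<in> takagi_humps" "r \<in> takagi_humps" "hump_base q \<inter> hump_base r = {}"
    "hump_range r = hump_range q" "hump_range q \<inter> V \<noteq> {}"
proof -
  obtain y where y: "y \<in> V" "y \<in> {0..2/3}" using assms(2) by fastforce
  obtain x where x: "x \<in> {0..1/3}" "takagi x = y" using takagi_attains[OF y(2)] by metis
  have "open (takagi -` V)"
    using assms(1) continuous_on_takagi[of UNIV] by (metis continuous_open_vimage continuous_on_eq_continuous_at open_UNIV UNIV_I)
  then obtain \<epsilon> where \<epsilon>: "\<epsilon> > 0" "ball x \<epsilon> \<subseteq> takagi -` V" using x y by (metis openE vimageI)
  \<comment> \<open>The radius 1/6 = 1/2 - 1/3 keeps the hump to the left of 1/2, and the other
    bound keeps its values in \<open>V\<close>.\<close>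
  have "x \<in> {0..1}" "0 < min \<epsilon> (1 / 6)" using x \<epsilon> by auto
  then obtain p where p: "p \<in> takagi_humps" "hump_base p \<subseteq> ball x (min \<epsilon> (1 / 6))"
    by (rule takagi_humps_dense)
  obtain a n where p_eq: "p = (a, n)" by force
  have sub: "{a..a + 1 / 2 ^ n} \<subseteq> ball x (min \<epsilon> (1 / 6))" using p(2) by (simp add: p_eq hump_base_def)
  have "a \<in> {a..a + 1 / 2 ^ n}" "a + 1 / 2 ^ n \<in> {a..a + 1 / 2 ^ n}" by auto
  then have "a \<in> ball x (min \<epsilon> (1 / 6))" "a + 1 / 2 ^ n \<in> ball x (min \<epsilon> (1 / 6))"
    using sub by blast+
  then have a: "a \<in> ball x \<epsilon>" "a + 1 / 2 ^ n \<in> ball x (1 / 6)" by simp_all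
  then have "a + 1 / 2 ^ n < x + 1 / 6" unfolding mem_ball dist_real_def by linarith
  then have half: "a + 1 / 2 ^ n < 1 / 2" using x(1) unfolding atLeastAtMost_iff by linarith
  let ?r = "(1 - a - 1 / 2 ^ n, n)"
  have "hump_range p \<inter> V \<noteq> {}"
  proof -
    have "takagi a \<in> V" using a \<epsilon> by auto
    then obtain \<eta> where \<eta>: "\<eta> > 0" "ball (takagi a) \<eta> \<subseteq> V" using assms(1) by (metis openE)
    \<comment> \<open>The value \<open>takagi a\<close> is the excluded lower end of the open range,
      so a slightly larger value is used.\<close>
    define z where "z = takagi a + min (\<eta> / 2) (1 / 3 / 2 ^ n)"
    have "min (\<eta> / 2) (1 / 3 / 2 ^ n) > 0" "min (\<eta> / 2) (1 / 3 / 2 ^ n) < \<eta>"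
      "min (\<eta> / 2) (1 / 3 / 2 ^ n) < 2 / 3 / 2 ^ n"
      using \<eta>(1) by (auto simp: min_less_iff_disj field_simps)
    then have "z \<in> hump_range p" "z \<in> ball (takagi a) \<eta>"
      by (auto simp: z_def hump_range_def p_eq dist_real_def)
    with \<eta> show ?thesis by auto
  qed
  moreover have "hump_base p \<inter> hump_base ?r = {}" using half by (auto simp: hump_base_def p_eq)
  moreover have "hump_range ?r = hump_range p"
    using takagi_hump_reflect(2)[of a n] p by (simp add: hump_range_def p_eq)
  moreover have "?r \<in> takagi_humps" using takagi_hump_reflect(1)[of a n] p by (simp add: p_eq)
  ultimately show thesis using p(1) that by blast
qed

lemma doubly_covered_dense:
  assumes p: "p \<in> takagi_humps" and V: "open V" "V \<inter> hump_range p \<noteq> {}"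
  obtains W where "open W" "W \<noteq> {}" "W \<subseteq> V \<inter> hump_range p" "W \<subseteq> doubly_covered p"
proof -
  obtain a n where p_eq: "p = (a, n)" by force
  \<comment> \<open>\<open>f\<close> acts on heights and \<open>g\<close> on abscissas; together
    they map the whole graph onto its copy over \<open>p\<close>. The symmetric pair is found for
    the pulled-back set and then pushed forward.\<close>
  define f where "f = (\<lambda>y. takagi a + y / 2 ^ n)"
  define g where "g = (\<lambda>t :: real. a + t / 2 ^ n)"
  have comp: "(a + b / 2 ^ n, n + m) \<in> takagi_humps \<and>
      hump_base (a + b / 2 ^ n, n + m) = g ` hump_base (b, m) \<and>
      hump_range (a + b / 2 ^ n, n + m) = f ` hump_range (b, m)" if "(b, m) \<in> takagi_humps" for b m
    using takagi_humps_comp[OF p[unfolded p_eq] that] by (simp add: f_def g_def)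
  have p_img: "hump_base p = g ` {0..1}" "hump_range p = f ` {0<..<2/3}"
    using comp[OF unit_hump(1)] by (simp_all add: unit_hump p_eq)
  have "open (f -` V)" unfolding f_def
    by (intro open_vimage V(1)) (auto intro!: continuous_intros)
  moreover have "f -` V \<inter> {0<..<2/3} \<noteq> {}" using V(2) unfolding p_img by blast
  ultimately obtain q r where qr: "q \<in> takagi_humps" "r \<in> takagi_humps"
    "hump_base q \<inter> hump_base r = {}" "hump_range r = hump_range q" "hump_range q \<inter> f -` V \<noteq> {}"
    by (rule symmetric_humps)
  obtain b m c k where eqs: "q = (b, m)" "r = (c, k)" by force
  let ?q = "(a + b / 2 ^ n, n + m)" and ?r = "(a + c / 2 ^ n, n + k)"
  note q = comp[OF qr(1)[unfolded eqs]] and r = comp[OF qr(2)[unfolded eqs]]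
  have "inj g" by (auto simp: inj_def g_def)
  then have disj: "hump_base ?q \<inter> hump_base ?r = {}"
    using q r qr(3) unfolding eqs by (metis image_Int image_empty)
  have unit: "hump_base s \<subseteq> {0..1}" if "s \<in> takagi_humps" for s
    using that by (cases s) (auto simp: hump_base_def takagi_humps_iff)
  have sub: "hump_base ?q \<subseteq> hump_base p" "hump_base ?r \<subseteq> hump_base p"
    using q r unit[OF qr(1)] unit[OF qr(2)] unfolding p_img eqs by (metis image_mono)+
  have range_eq: "hump_range ?r = hump_range ?q" using q r qr(4) unfolding eqs by simp
  have "hump_range ?q \<subseteq> hump_range p"
    using q hump_range_subset[OF qr(1)] unfolding p_img eqs by (metis image_mono)
  moreover have "hump_range ?q \<inter> V \<noteq> {}" using q qr(5) unfolding eqs by auto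
  moreover have "open (hump_range ?q)" by (simp add: hump_range_def)
  moreover have "hump_range ?q \<subseteq> doubly_covered p"
  proof
    fix y assume "y \<in> hump_range ?q"
    with q r disj sub range_eq show "y \<in> doubly_covered p"
      unfolding doubly_covered_def
      by (intro CollectI bexI[of _ ?q] bexI[of _ ?r]) simp_all
  qed
  ultimately show thesis using that[of "hump_range ?q \<inter> V"] V(1) by blast
qed

subsection \<open>Uncountable level sets\<close>

lemma uncountable_UNIV_nat_bool: "uncountable (UNIV :: (nat \<Rightarrow> bool) set)"
proof
  assume "countable (UNIV :: (nat \<Rightarrow> bool) set)"
  then obtain e :: "nat \<Rightarrow> nat \<Rightarrow> bool" where "surj e"
    by (metis UNIV_not_empty uncountable_def)
  \<comment> \<open>Cantor's diagonal sequence.\<close>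
  then obtain k where "e k = (\<lambda>n. \<not> e n n)" by (metis surjD)
  then show False by (metis (full_types))
qed

lemma uncountable_takagi_level:
  assumes y: "y \<in> {0<..<2/3}"
    and cov: "\<And>p. p \<in> takagi_humps \<Longrightarrow> y \<in> hump_range p \<Longrightarrow> y \<in> doubly_covered p"
  shows "uncountable (takagi_level y)"
proof -
  \<comment> \<open>By \<open>cov\<close>, every member of \<open>H\<close> has two disjoint
    subhumps that are again in \<open>H\<close>; these are the two children chosen by
    \<open>F\<close>.\<close>
  define H where "H = {p \<in> takagi_humps. y \<in> hump_range p}"
  have "\<exists>F. \<forall>i. F i \<in> H \<and> hump_base (F i) \<subseteq> hump_base p \<and> hump_base (F True) \<inter> hump_base (F False) = {}"
    if p: "p \<in> H" for p
  proof -
    obtain q r where "q \<in> H" "r \<in> H" "hump_base q \<subseteq> hump_base p" "hump_base r \<subseteq> hump_base p"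
      "hump_base q \<inter> hump_base r = {}"
      using cov[of p] p unfolding H_def doubly_covered_def by blast
    then show ?thesis by (intro exI[of _ "\<lambda>i. if i then q else r"]) auto
  qed
  then obtain F where F: "F p i \<in> H" "hump_base (F p i) \<subseteq> hump_base p"
      "hump_base (F p True) \<inter> hump_base (F p False) = {}" if "p \<in> H" for p and i :: bool
    by metis
  \<comment> \<open>\<open>P s\<close> follows the branch of the binary tree prescribed by
    \<open>s\<close>, so \<open>P s k\<close> depends only on the first \<open>k\<close> bits of
    \<open>s\<close>.\<close>
  define P where "P s = rec_nat (0, 0) (\<lambda>k p. F p (s k))" for s
  have P_0: "P s 0 = (0, 0)" and P_Suc: "P s (Suc k) = F (P s k) (s k)" for s k
    by (simp_all add: P_def)
  have P_H: "P s k \<in> H" for s k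
    by (induction k) (use y unit_hump F(1) in \<open>auto simp: P_0 P_Suc H_def[symmetric]\<close>, simp add: H_def unit_hump)
  \<comment> \<open>Intersecting with the closed level set makes any common point solve
    \<open>takagi x = y\<close> at once; no shrinking of the bases is required.\<close>
  define C where "C s k = hump_base (P s k) \<inter> takagi -` {y}" for s k
  have "\<Inter>(range (C s)) \<noteq> {}" for s
  proof (rule compact_nest)
    fix k
    have "compact (hump_base (P s k))" by (cases "P s k") (simp add: hump_base_def)
    moreover have "closed (takagi -` {y})"
      by (intro closed_vimage continuous_on_takagi) auto
    ultimately show "compact (C s k)" unfolding C_def by (rule compact_Int_closed)
    show "C s k \<noteq> {}" using hump_range_attained[of "P s k" y] P_H[of s k] by (auto simp: C_def H_def)
  next
    fix j k :: nat assume "j \<le> k"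
    then show "C s k \<subseteq> C s j"
      by (rule lift_Suc_antimono_le[rotated]) (use F(2) P_H in \<open>fastforce simp: C_def P_Suc\<close>)
  qed
  then have "\<forall>s. \<exists>x. \<forall>k. x \<in> C s k" by blast
  then obtain x where x: "x s \<in> C s k" for s k by metis
  have "inj x"
  proof (rule injI, rule ccontr)
    fix s s' assume eq: "x s = x s'" and "s \<noteq> s'"
    then have ex: "\<exists>k. s k \<noteq> s' k" by auto
    \<comment> \<open>At the first disagreement both branches are still at the same node, and they
      then pass to its two disjoint children.\<close>
    define k where "k = (LEAST k. s k \<noteq> s' k)"
    have k: "s k \<noteq> s' k" unfolding k_def by (rule LeastI_ex[OF ex])
    have "s j = s' j" if "j < k" for j using that not_less_Least unfolding k_def by blast
    then have "P s j = P s' j" if "j \<le> k" for j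
      using that by (induction j) (auto simp: P_0 P_Suc)
    then have "P s k = P s' k" by simp
    then have "hump_base (P s (Suc k)) \<inter> hump_base (P s' (Suc k)) = {}"
      using k F(3)[OF P_H[of s k]] by (cases "s k"; cases "s' k") (auto simp: P_Suc)
    moreover have "x s \<in> hump_base (P s (Suc k))" "x s \<in> hump_base (P s' (Suc k))"
      using x[of s "Suc k"] x[of s' "Suc k"] eq by (auto simp: C_def)
    ultimately show False by blast
  qed
  then have "uncountable (range x)" using uncountable_UNIV_nat_bool countable_image_inj_on by blast
  moreover have "range x \<subseteq> takagi_level y"
    using x[of _ 0] by (auto simp: takagi_level_def C_def P_0 unit_hump)
  ultimately show ?thesis using countable_subset by blast
qed

section \<open>The category argument\<close>

lemma nowhere_dense_in_top_of_set:
  fixes A C :: "'a::topological_space set"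
  assumes "A \<subseteq> C"
    and dense: "\<And>V. open V \<Longrightarrow> V \<inter> C \<noteq> {} \<Longrightarrow> \<exists>W. open W \<and> W \<noteq> {} \<and> W \<subseteq> V \<inter> C - A"
  shows "nowhere_dense_in (top_of_set C) A"
proof -
  let ?X = "top_of_set C"
  have "?X interior_of (?X closure_of A) = {}"
  proof (rule ccontr)
    assume "?X interior_of (?X closure_of A) \<noteq> {}"
    then obtain V where V: "open V" "V \<inter> C \<noteq> {}" "C \<inter> V \<subseteq> ?X closure_of A"
      unfolding interior_of_def openin_open by blast
    obtain W where W: "open W" "W \<noteq> {}" "W \<subseteq> V \<inter> C - A" using dense[OF V(1,2)] by blast
    then have "openin ?X W" by (metis Diff_subset Int_lower2 openin_open_eq openin_subtopology open_openin inf.absorb1 subset_trans)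
    moreover have "W \<inter> A = {}" using W by blast
    \<comment> \<open>A relatively open set missing \<open>A\<close> also misses its closure, yet
      \<open>W\<close> is a nonempty part of \<open>V\<close> inside \<open>C\<close>.\<close>
    ultimately have "W \<inter> ?X closure_of A = {}" by (simp add: openin_Int_closure_of_eq_empty)
    then show False using W V(3) by blast
  qed
  then show ?thesis using assms(1) by (simp add: nowhere_dense_in_def)
qed

text \<open>By the contrapositive of \<open>uncountable_takagi_level\<close>, each exceptional value
  strictly between 0 and 2/3 lies in the range of some hump where it is not doubly covered. One
  nowhere dense set per hump, plus the exceptional endpoints, is a countable family.\<close>

lemma complement_S_inf_uc_meager: "meager_in (top_of_set {0..2/3}) ({0..2/3} - S_inf_uc)"
proof -
  let ?A = "{0..2/3} - S_inf_uc" and ?I = "{0<..<2/3} :: real set"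
  \<comment> \<open>The intersection with \<open>?A\<close> makes the union equal to
    \<open>?A\<close>, since \<open>meager_in\<close> asks for equality rather than
    inclusion.\<close>
  define B where "B p = (hump_range p - doubly_covered p) \<inter> ?A" for p
  let ?\<F> = "insert (?A - ?I) (B ` takagi_humps)"
  \<comment> \<open>The closed interval is the closure of the open one.\<close>
  have meets: "V \<inter> ?I \<noteq> {}" if "open V" "V \<inter> {0..2/3} \<noteq> {}" for V
    using that open_Int_closure_eq_empty[of V ?I] by (simp add: Int_commute)
  have B_nd: "nowhere_dense_in (top_of_set {0..2/3}) (B p)" if p: "p \<in> takagi_humps" for p
  proof (rule nowhere_dense_in_top_of_set)
    fix V :: "real set" assume V: "open V" "V \<inter> {0..2/3} \<noteq> {}"
    show "\<exists>W. open W \<and> W \<noteq> {} \<and> W \<subseteq> V \<inter> {0..2/3} - B p"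
    proof (cases "V \<inter> hump_range p = {}")
      case True
      then show ?thesis using V(1) meets[OF V] by (intro exI[of _ "V \<inter> ?I"]) (auto simp: B_def)
    next
      case False
      obtain W where "open W" "W \<noteq> {}" "W \<subseteq> V \<inter> hump_range p" "W \<subseteq> doubly_covered p"
        by (rule doubly_covered_dense[OF p V(1) False])
      moreover have "hump_range p \<subseteq> {0..2/3}"
        using hump_range_subset[OF p] by (meson greaterThanLessThan_subseteq_atLeastAtMost_iff order_refl subset_trans)
      ultimately show ?thesis by (intro exI[of _ W]) (auto simp: B_def)
    qed
  qed (auto simp: B_def)
  have "nowhere_dense_in (top_of_set {0..2/3}) (?A - ?I)"
  proof (rule nowhere_dense_in_top_of_set)
    fix V :: "real set" assume V: "open V" "V \<inter> {0..2/3} \<noteq> {}"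
    then show "\<exists>W. open W \<and> W \<noteq> {} \<and> W \<subseteq> V \<inter> {0..2/3} - (?A - ?I)"
      using meets[OF V] by (intro exI[of _ "V \<inter> ?I"]) auto
  qed auto
  with B_nd have "\<forall>N\<in>?\<F>. nowhere_dense_in (top_of_set {0..2/3}) N" by blast
  moreover have "countable ?\<F>" using countable_takagi_humps by simp
  moreover have "?A = \<Union>?\<F>"
  proof
    show "?A \<subseteq> \<Union>?\<F>"
      using uncountable_takagi_level unfolding B_def S_inf_uc_def by blast
  qed (auto simp: B_def)
  ultimately show ?thesis unfolding meager_in_def by blast
qed

theorem theorem6:
  shows "takagi ` {0..1} = {0..2/3} \<and> residual_in (top_of_set {0..2/3}) S_inf_uc"
proof -
  \<comment> \<open>\<open>S_inf_uc\<close> ranges over all reals, whereas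
    \<open>residual_in\<close> demands a subset of the space; values outside the range have empty
    level sets.\<close>
  have "y \<in> {0..2/3}" if "y \<in> S_inf_uc" for y
  proof (rule ccontr)
    assume "y \<notin> {0..2/3}"
    then have "takagi_level y = {}" using takagi_range by (auto simp: takagi_level_def)
    with that show False by (simp add: S_inf_uc_def)
  qed
  then show ?thesis using takagi_range complement_S_inf_uc_meager by (auto simp: residual_in_def)
qed

end
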